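(* Let $n\ge2$. Suppose the sequence $(\varepsilon_j)_{j\in\mathbb{N}}\subset(0,1)$, that $(\ell_j)_{j\in\mathbb{N}}\subset(0,\infty)$ is decreasing, that $c',\eta>0$ and $M\in\mathbb{N}$, and that $$\ell_j\le\frac{c'}{\Big(j\prod_{m=1}^{M-1}\log_m(j+\mathrm{e}_m)\Big)^{1/n}\log_M^{1+\eta}(j+\mathrm{e}_M)},\qquad j\in\mathbb{N}.$$ Then there exists a choice of the sequence of translations $(t_j)_{j\in\mathbb{N}}\subset\mathbb{R}^n$ such that the sequences $(\mathcal{O}_j)_{j\in\mathbb{N}}$ and $(\Gamma_j)_{j\in\mathbb{N}}$, defined by $\mathcal{O}_j:=\ell_j\mathcal{O}+t_j$ and $\Gamma_j:=\ell_j\Gamma^{\varepsilon_j}+t_j$ for $j\in\mathbb{N}$, satisfy: (i) $\overline{\mathcal{O}_i}\cap\overline{\mathcal{O}_j}=\varnothing$ for $i\neq j$ (and hence $\Gamma_i\cap\Gamma_j=\varnothing$ for $i\ne j$); (ii) $\mathcal{O}_\infty:=\bigcup_{j=1}^\infty\mathcal{O}_j$ is bounded, so that $\Gamma:=\overline{\bigcup_{j=1}^\infty\Gamma_j}\subset\partial\mathcal{O}_\infty$ is compact; (iii) $\Omega:=\mathbb{R}^n\setminus\Gamma$ is connected. Further, for some $x_\infty\in\mathbb{R}^n$, $$\Gamma=\overline{\bigcup_{j=1}^\infty\Gamma_j}=\{x_\infty\}\cup\bigcup_{j=1}^\infty\Gamma_j.$$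
   Context: For $S\subset\mathbb{R}^n$, $\ell>0$, $t\in\mathbb{R}^n$: $\ell S+t:=\{\ell x+t:x\in S\}$. $\mathcal{O}:=\{x=(x_1,\dots,x_n)\in\mathbb{R}^n:0<x_i<1\text{ for }i=1,\dots,n\}$ is the open unit cube. For $0<\varepsilon<1$, $\Gamma^\varepsilon:=\partial\mathcal{O}\setminus\{x=(x_1,\dots,x_n)\in\mathbb{R}^n:x_n=0\text{ and }0<x_i<\varepsilon\text{ for }i=1,\dots,n-1\}$, i.e. $\partial\mathcal{O}$ with an $(n-1)$-dimensional open cube of sidelength $\varepsilon$ removed from one face. Iterated exponentials and logarithms: $\mathrm{e}_1:=\mathrm{e}$, $\mathrm{e}_{m+1}:=\exp(\mathrm{e}_m)$; $\log_1(x):=\log(x)$ (natural logarithm), $\log_{m+1}(x):=\log(\log_m(x))$, for $m\in\mathbb{N}$ (wherever defined; in particular at $x=j+\mathrm{e}_m$ for $\log_m$). $\log_M^{1+\eta}(x)$ means $(\log_M(x))^{1+\eta}$. The product $\prod_{m=1}^{M-1}$ equals $1$ if $M=1$. *)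

theory Defs
  imports "HOL-Analysis.Analysis"
begin

text \<open>
  Index 0 (values 1 and x) only starts the recursion: index 1 gives \<open>e\<close> and \<open>log x\<close>.
\<close>

primrec iter_exp :: "nat \<Rightarrow> real" where
  "iter_exp 0 = 1"
| "iter_exp (Suc m) = exp (iter_exp m)"

primrec iter_log :: "nat \<Rightarrow> real \<Rightarrow> real" where
  "iter_log 0 x = x"
| "iter_log (Suc m) x = ln (iter_log m x)"

definition scale_shift :: "real \<Rightarrow> (real ^ 'n) set \<Rightarrow> real ^ 'n \<Rightarrow> (real ^ 'n) set" where
  "scale_shift l S t = (\<lambda>x. l *\<^sub>R x + t) ` S"

definition unit_cube :: "(real ^ 'n) set" where
  "unit_cube = {x. \<forall>i. 0 < x $ i \<and> x $ i < 1}"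

text \<open>
  The index type carries no order, so the coordinate written \<open>x\<^sub>n\<close> on paper (the one normal to the
  perforated face) is the parameter \<open>k\<close>; the coordinates \<open>x\<^sub>1, ..., x\<^sub>n\<^sub>-\<^sub>1\<close> are those with index
  different from \<open>k\<close>.
\<close>

definition perforated_boundary :: "'n \<Rightarrow> real \<Rightarrow> (real ^ 'n) set" where
  "perforated_boundary k \<epsilon> =
     frontier unit_cube - {x. x $ k = 0 \<and> (\<forall>i. i \<noteq> k \<longrightarrow> 0 < x $ i \<and> x $ i < \<epsilon>)}"

end

theory Submission
  imports Defs
begin

text \<open>
  A telescoping bound by \<open>(iter_log M j) powr (-\<eta>)\<close> shows that the cubes have finite total volume,
  and this is all that is needed. Cubes enlarged to dyadic sizes, placed greedily into a sequence of
  disjoint dyadic boxes that shrink to the origin, have pairwise disjoint interiors, and the origin is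
  their only accumulation point. Each perforated boundary lies well inside its enlarged cube, and
  removing it from that cube leaves a connected set. Gluing along these enlarged cubes, a disconnection
  of the domain would therefore disconnect the punctured space.
\<close>

subsection \<open>Iterated logarithms\<close>

text \<open>For cubes of arbitrary sizes, free volume does not guarantee a free place. Rounding
  every side up to a power of two removes this obstacle at the cost of a bounded factor: among
  dyadic cells of nonincreasing size, one uncovered point already yields a whole uncovered cell.
  Packing everything into one fixed box would give boundedness but no control over where the cubes
  accumulate. Each cube is therefore sent to a box whose volume is comparable to the tail of the
  series from that cube on, so that the boxes shrink with the tail. The enlargement has two more
  purposes: it keeps the closed cubes apart, and it surrounds each boundary by a margin through
  which all outer sides of the cube communicate, while the hole joins the margin to the interior.
  Dimension at least 2 enters in the connectedness of that margin and of the punctured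
  space.\<close>

lemma iter_log_Suc': "iter_log (Suc m) x = iter_log m (ln x)"
  by (induction m) auto

lemma iter_exp_ge_1: "1 \<le> iter_exp m"
  by (induction m) (auto intro: order_trans[OF zero_le_one])

lemma iter_exp_mono: "m \<le> n \<Longrightarrow> iter_exp m \<le> iter_exp n"
proof (rule lift_Suc_mono_le[of iter_exp])
  show "iter_exp n \<le> iter_exp (Suc n)" for n
    using exp_ge_add_one_self[of "iter_exp n"] by (simp del: exp_ge_add_one_self)
qed

text \<open>The threshold \<open>iter_exp m\<close> keeps every intermediate logarithm at least 1.
  The induction peels off the innermost logarithm, which turns
  \<open>iter_exp (Suc m) \<le> x\<close> into \<open>iter_exp m \<le> ln x\<close>.\<close>

lemma iter_log_mono: "iter_exp m \<le> x \<Longrightarrow> x \<le> y \<Longrightarrow> iter_log m x \<le> iter_log m y"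
proof (induction m arbitrary: x y)
  case (Suc m)
  have "0 < x" using Suc.prems(1) by (auto intro: less_le_trans[OF exp_gt_zero])
  moreover have "iter_exp m \<le> ln x"
    using Suc.prems(1) \<open>0 < x\<close> by (simp add: ln_ge_iff)
  ultimately show ?case
    unfolding iter_log_Suc' using Suc.prems(2) by (intro Suc.IH) auto
qed auto

lemma iter_log_ge_1: "iter_exp m \<le> x \<Longrightarrow> 1 \<le> iter_log m x"
proof (induction m arbitrary: x)
  case (Suc m)
  have "0 < x" using Suc.prems(1) by (auto intro: less_le_trans[OF exp_gt_zero])
  then have "iter_exp m \<le> ln x"
    using Suc.prems(1) by (simp add: ln_ge_iff)
  then show ?case
    unfolding iter_log_Suc' by (rule Suc.IH)
qed auto

text \<open>Chain rule. The product starts at \<open>m = 0\<close>, whose factor is \<open>x\<close>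
  itself; this factor later matches the isolated \<open>j\<close> in the bound on the side
  lengths.\<close>

lemma has_real_derivative_iter_log:
  assumes "iter_exp M \<le> x"
  shows "(iter_log M has_real_derivative 1 / (\<Prod>m<M. iter_log m x)) (at x)"
  using assms
proof (induction M)
  case 0
  have "iter_log 0 = (\<lambda>x. x)" by auto
  then show ?case by simp
next
  case (Suc M)
  have le: "iter_exp M \<le> x"
    using Suc.prems iter_exp_mono[of M "Suc M"] by simp
  then have "1 \<le> iter_log M x" by (rule iter_log_ge_1)
  then have "((\<lambda>x. ln (iter_log M x)) has_real_derivative
      inverse (iter_log M x) * (1 / (\<Prod>m<M. iter_log m x))) (at x)"
    by (intro DERIV_chain2[OF DERIV_ln Suc.IH[OF le]]) auto
  moreover have "iter_log (Suc M) = (\<lambda>x. ln (iter_log M x))" by auto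
  ultimately show ?case by (simp add: field_simps)
qed

lemma prod_iter_log_pos:
  assumes "iter_exp M \<le> x"
  shows "0 < (\<Prod>m<M. iter_log m x)"
proof (rule prod_pos)
  fix m assume "m \<in> {..<M}"
  then have "iter_exp m \<le> x"
    using assms iter_exp_mono[of m M] by simp
  then show "0 < iter_log m x" using iter_log_ge_1[of m x] by simp
qed

text \<open>
  The summand is, up to the factor \<open>\<eta>\<close>, minus the derivative of \<open>(iter_log M x) powr (-\<eta>)\<close>,
  so the series is dominated by a telescoping one.
\<close>

lemma summable_iter_log:
  assumes "\<eta> > 0"
  shows "summable (\<lambda>j::nat. 1 / ((\<Prod>m<M. iter_log m (real j)) * iter_log M (real j) powr (1 + \<eta>)))"
proof -
  define f where "f x = 1 / ((\<Prod>m<M. iter_log m x) * iter_log M x powr (1 + \<eta>))" for x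
  define h where "h x = iter_log M x powr (- \<eta>)" for x
  \<comment> \<open>From \<open>J\<close> on, all logarithms involved are at least 1. The finitely
    many earlier terms, which may contain default values of \<open>ln\<close>, do not affect
    summability.\<close>
  define J where "J = nat \<lceil>iter_exp M\<rceil>"
  have J: "iter_exp M \<le> real (n + J)" for n
    unfolding J_def using real_nat_ceiling_ge[of "iter_exp M"] by simp
  have deriv: "(h has_real_derivative - \<eta> * f x) (at x)" if "iter_exp M \<le> x" for x
  proof -
    have pos: "0 < iter_log M x" using iter_log_ge_1[OF that] by simp
    have "(h has_real_derivative
        (- \<eta>) * iter_log M x powr (- \<eta> - 1) * (1 / (\<Prod>m<M. iter_log m x))) (at x)"
      unfolding h_def
      using DERIV_fun_powr[OF has_real_derivative_iter_log[OF that] pos, of "- \<eta>"] by simp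
    moreover have "iter_log M x powr (- \<eta> - 1) = 1 / iter_log M x powr (1 + \<eta>)"
      by (metis minus_add_distrib powr_minus_divide uminus_add_conv_diff)
    ultimately show ?thesis by (simp add: f_def field_simps)
  qed
  have f_anti: "f y \<le> f x" if "iter_exp M \<le> x" "x \<le> y" for x y
  proof -
    have "(\<Prod>m<M. iter_log m x) \<le> (\<Prod>m<M. iter_log m y)"
    proof (rule prod_mono)
      fix m assume "m \<in> {..<M}"
      then have "iter_exp m \<le> x"
        using that iter_exp_mono[of m M] by simp
      then show "0 \<le> iter_log m x \<and> iter_log m x \<le> iter_log m y"
        using iter_log_ge_1[of m x] iter_log_mono[of m x y] that by simp
    qed
    moreover have "iter_log M x powr (1 + \<eta>) \<le> iter_log M y powr (1 + \<eta>)"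
      using iter_log_ge_1[OF that(1)] iter_log_mono[OF that] assms
      by (intro powr_mono2) auto
    moreover have "0 < iter_log M x powr (1 + \<eta>)"
      using iter_log_ge_1[OF that(1)] by simp
    ultimately show ?thesis
      unfolding f_def using prod_iter_log_pos[OF that(1)]
      by (intro divide_left_mono mult_mono mult_pos_pos) auto
  qed
  have f_nonneg: "0 \<le> f x" if "iter_exp M \<le> x" for x
    using prod_iter_log_pos[OF that] by (simp add: f_def)
  \<comment> \<open>By the mean value theorem on a unit interval the decrement of \<open>h\<close>
    is \<open>\<eta> * f z\<close> for an interior \<open>z\<close>, and \<open>f\<close> is smaller
    still at the right endpoint.\<close>
  have step: "\<eta> * f (real (Suc n + J)) \<le> h (real (n + J)) - h (real (Suc n + J))" for n
  proof -
    have "\<exists>z. real (n + J) < z \<and> z < real (Suc n + J) \<and>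
        h (real (Suc n + J)) - h (real (n + J)) =
          (real (Suc n + J) - real (n + J)) * (- \<eta> * f z)"
      using J[of n] by (intro MVT2 deriv) auto
    then obtain z where z: "real (n + J) < z" "z < real (Suc n + J)"
      and eq: "h (real (Suc n + J)) - h (real (n + J)) = - \<eta> * f z" by auto
    have "\<eta> * f (real (Suc n + J)) \<le> \<eta> * f z"
      using z J[of n] assms by (intro mult_left_mono f_anti) auto
    then show ?thesis using eq by simp
  qed
  have "decseq (\<lambda>n. h (real (n + J)))"
  proof (rule decseq_SucI)
    fix n
    show "h (real (Suc n + J)) \<le> h (real (n + J))"
      using step[of n] f_nonneg[OF J[of "Suc n"]] assms
      by (smt (verit) mult_nonneg_nonneg)
  qed
  moreover have "0 \<le> h x" for x by (simp add: h_def)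
  ultimately obtain L where "(\<lambda>n. h (real (n + J))) \<longlonglongrightarrow> L"
    using decseq_convergent by blast
  then have "summable (\<lambda>n. h (real (n + J)) - h (real (Suc n + J)))"
    using telescope_summable' by blast
  then have "summable (\<lambda>n. \<eta> * f (real (Suc n + J)))"
  proof (rule summable_comparison_test')
    show "norm (\<eta> * f (real (Suc n + J))) \<le> h (real (n + J)) - h (real (Suc n + J))"
      if "0 \<le> n" for n
      using step[of n] f_nonneg[OF J[of "Suc n"]] assms by simp
  qed
  then have "summable (\<lambda>n. f (real (n + Suc J)))"
    using assms by (simp add: summable_cmult_iff)
  then show ?thesis
    unfolding f_def by (subst (asm) summable_iff_shift)
qed

text \<open>The power \<open>n\<close> cancels the root \<open>1 / n\<close>. Dropping the shifts by
  \<open>iter_exp m\<close> only lowers the logarithms and so weakens the bound. The last logarithm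
  is at least 1, so its exponent \<open>n * (1 + \<eta>)\<close> may be lowered to
  \<open>1 + \<eta>\<close>.\<close>

lemma summable_power_of_iter_log_bound:
  fixes l :: "nat \<Rightarrow> real" and n :: nat
  assumes "n \<ge> 1" "\<eta> > 0" "M \<ge> 1" "c > 0"
    and pos: "\<And>j. j \<ge> 1 \<Longrightarrow> 0 < l j"
    and le: "\<And>j. j \<ge> 1 \<Longrightarrow>
      l j \<le> c / ((real j * (\<Prod>m\<in>{1..<M}. iter_log m (real j + iter_exp m))) powr (1 / real n)
                 * iter_log M (real j + iter_exp M) powr (1 + \<eta>))"
  shows "summable (\<lambda>j. l j ^ n)"
proof (rule summable_comparison_test')
  show "summable (\<lambda>j::nat. c ^ n *
      (1 / ((\<Prod>m<M. iter_log m (real j)) * iter_log M (real j) powr (1 + \<eta>))))"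
    by (intro summable_mult summable_iter_log assms)
  fix j :: nat
  assume "nat \<lceil>iter_exp M\<rceil> \<le> j"
  then have j: "iter_exp M \<le> real j"
    by (simp add: ceiling_le_iff nat_le_iff)
  then have "1 \<le> j" using iter_exp_ge_1[of M] by simp
  have jm: "iter_exp m \<le> real j" if "m \<le> M" for m
    using iter_exp_mono[OF that] j by simp
  define P where "P = (\<Prod>m<M. iter_log m (real j))"
  define P' where "P' = real j * (\<Prod>m\<in>{1..<M}. iter_log m (real j + iter_exp m))"
  define L where "L = iter_log M (real j) powr (1 + \<eta>)"
  define L' where "L' = iter_log M (real j + iter_exp M) powr (1 + \<eta>)"
  have "{..<M} = insert 0 {1..<M}" using \<open>M \<ge> 1\<close> by auto
  then have P: "P = real j * (\<Prod>m\<in>{1..<M}. iter_log m (real j))"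
    by (simp add: P_def)
  have log_le: "0 \<le> iter_log m (real j) \<and>
      iter_log m (real j) \<le> iter_log m (real j + iter_exp m)" if "m \<le> M" for m
    using iter_log_mono[OF jm[OF that], of "real j + iter_exp m"]
      iter_log_ge_1[OF jm[OF that]] iter_exp_ge_1[of m] by simp
  have "P \<le> P'"
    unfolding P P'_def using log_le by (intro mult_left_mono prod_mono) auto
  have "0 < P" unfolding P_def by (rule prod_iter_log_pos[OF j])
  have "1 \<le> L"
    unfolding L_def using iter_log_ge_1[OF j] assms by (intro ge_one_powr_ge_zero) auto
  have "L \<le> L'"
    unfolding L_def L'_def using log_le[of M] assms by (intro powr_mono2) auto
  have "l j ^ n \<le> (c / (P' powr (1 / real n) * L')) ^ n"
    using le[OF \<open>1 \<le> j\<close>] pos[OF \<open>1 \<le> j\<close>]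
    unfolding P'_def L'_def by (intro power_mono) auto
  also have "\<dots> = c ^ n / (P' * L' ^ n)"
    using \<open>n \<ge> 1\<close> \<open>0 < P\<close> \<open>P \<le> P'\<close>
    by (simp add: power_divide power_mult_distrib powr_power)
  also have "\<dots> \<le> c ^ n / (P * L)"
  proof (rule divide_left_mono)
    have "L \<le> L ^ n" using \<open>1 \<le> L\<close> \<open>n \<ge> 1\<close> by (simp add: self_le_power)
    also have "\<dots> \<le> L' ^ n" using \<open>1 \<le> L\<close> \<open>L \<le> L'\<close> by (intro power_mono) auto
    finally show "P * L \<le> P' * L' ^ n"
      using \<open>0 < P\<close> \<open>P \<le> P'\<close> \<open>1 \<le> L\<close> by (intro mult_mono) auto
    show "0 < P' * L' ^ n * (P * L)"
      using \<open>0 < P\<close> \<open>P \<le> P'\<close> \<open>1 \<le> L\<close> \<open>L \<le> L'\<close> by (intro mult_pos_pos zero_less_power) auto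
  qed (use \<open>c > 0\<close> in auto)
  finally show "norm (l j ^ n) \<le> c ^ n *
      (1 / ((\<Prod>m<M. iter_log m (real j)) * iter_log M (real j) powr (1 + \<eta>)))"
    using pos[OF \<open>1 \<le> j\<close>] by (simp add: P_def L_def)
qed

lemma tendsto_zero_of_summable_power:
  fixes f :: "nat \<Rightarrow> real"
  assumes "\<And>j. 0 \<le> f j" and "n > 0" and "summable (\<lambda>j. f j ^ n)"
  shows "f \<longlonglongrightarrow> 0"
proof -
  have "(\<lambda>j. root n (f j ^ n)) \<longlonglongrightarrow> root n 0"
    by (intro tendsto_real_root summable_LIMSEQ_zero assms)
  then show ?thesis using assms by (simp add: real_root_power_cancel)
qed

subsection \<open>Packing by dyadic cells\<close>

text \<open>The half-open grid cube of side \<open>2 powi (- a)\<close> that contains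
  \<open>x\<close>. Any point of the cube can serve as \<open>x\<close>, so the cells of one level
  are the classes of an equivalence relation and partition the space; negative \<open>a\<close>
  gives large cells.\<close>

definition dyadic_cell :: "int \<Rightarrow> real ^ 'n \<Rightarrow> (real ^ 'n) set" where
  "dyadic_cell a x = {y. \<forall>i. \<lfloor>2 powi a * y $ i\<rfloor> = \<lfloor>2 powi a * x $ i\<rfloor>}"

definition cell_corner :: "int \<Rightarrow> real ^ 'n \<Rightarrow> real ^ 'n" where
  "cell_corner a x = (\<chi> i. \<lfloor>2 powi a * x $ i\<rfloor> * 2 powi (- a))"

text \<open>The fine floor determines the coarse one: it is the integer quotient by
  \<open>N\<close>, the ratio of the two sides.\<close>

lemma dyadic_cell_mono:
  assumes "a \<le> b"
  shows "dyadic_cell b x \<subseteq> dyadic_cell a x"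
proof
  fix y assume y: "y \<in> dyadic_cell b x"
  define N :: int where "N = 2 ^ nat (b - a)"
  have eq: "2 powi a * u = 2 powi b * u / real_of_int N" for u :: real
  proof -
    have "(2::real) powi b = 2 powi a * 2 powi (b - a)"
      by (simp add: power_int_diff)
    then show ?thesis using assms by (simp add: N_def power_int_def)
  qed
  have "\<lfloor>2 powi a * u\<rfloor> = \<lfloor>2 powi b * u\<rfloor> div N" for u :: real
    unfolding eq using floor_divide_real_eq_div[of N "2 powi b * u"] by (simp add: N_def)
  then show "y \<in> dyadic_cell a x"
    using y by (simp add: dyadic_cell_def)
qed

lemma mem_dyadic_cell_iff:
  "y \<in> dyadic_cell a x \<longleftrightarrow>
     (\<forall>i. cell_corner a x $ i \<le> y $ i \<and> y $ i < cell_corner a x $ i + 2 powi (- a))"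
proof -
  have "\<lfloor>2 powi a * u\<rfloor> = z \<longleftrightarrow> real_of_int z * 2 powi (- a) \<le> u \<and> u < real_of_int z * 2 powi (- a) + 2 powi (- a)"
    for u :: real and z
    by (simp add: floor_eq_iff power_int_minus field_simps)
  then show ?thesis by (simp add: dyadic_cell_def cell_corner_def)
qed

lemma mem_dyadic_cell_self: "x \<in> dyadic_cell a x"
  by (simp add: dyadic_cell_def)

lemma measure_cube_cart:
  fixes x :: "real ^ 'n::finite"
  assumes "0 \<le> w"
  shows "measure lebesgue (cbox x (x + vec w)) = w ^ CARD('n)"
    and "measure lebesgue (box x (x + vec w)) = w ^ CARD('n)"
proof -
  have le: "x \<bullet> b \<le> (x + vec w) \<bullet> b" if "b \<in> Basis" for b
    using that assms by (auto simp: Basis_vec_def inner_axis)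
  have eq: "(\<Prod>b\<in>Basis. (x + vec w - x) \<bullet> b) = w ^ CARD('n)"
  proof -
    have "(\<Prod>b\<in>Basis. (x + vec w - x) \<bullet> b) = (\<Prod>b\<in>(Basis::(real^'n) set). w)"
      by (intro prod.cong refl) (auto simp: Basis_vec_def inner_axis)
    then show ?thesis by simp
  qed
  show "measure lebesgue (cbox x (x + vec w)) = w ^ CARD('n)"
    using le eq by (simp add: measure_lborel_cbox_eq)
  show "measure lebesgue (box x (x + vec w)) = w ^ CARD('n)"
    using le eq by (simp add: measure_lborel_box_eq)
qed

text \<open>Subadditivity of volume. The half-open cells are replaced by closed cubes on the
  covering side and by an open cube on the covered side, which leaves their volumes
  unchanged.\<close>

lemma dyadic_cell_not_covered:
  fixes x :: "nat \<Rightarrow> real ^ 'n::finite"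
  assumes "finite I"
    and less: "(\<Sum>i\<in>I. (2 powi (- a i)) ^ CARD('n)) < (2 powi (- p) :: real) ^ CARD('n)"
  shows "\<exists>y \<in> dyadic_cell p q. \<forall>i\<in>I. y \<notin> dyadic_cell (a i) (x i)"
proof (rule ccontr)
  let ?C = "\<lambda>i. cbox (cell_corner (a i) (x i)) (cell_corner (a i) (x i) + vec (2 powi (- a i)))"
  let ?B = "box (cell_corner p q) (cell_corner p q + vec (2 powi (- p)))"
  assume "\<not> ?thesis"
  moreover have "?B \<subseteq> dyadic_cell p q"
    by (auto simp: mem_box_cart mem_dyadic_cell_iff less_imp_le)
  ultimately have "?B \<subseteq> (\<Union>i\<in>I. dyadic_cell (a i) (x i))" by blast
  also have "\<dots> \<subseteq> (\<Union>i\<in>I. ?C i)"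
    by (intro UN_mono) (auto simp: mem_box_cart mem_dyadic_cell_iff less_imp_le)
  finally have sub: "?B \<subseteq> (\<Union>i\<in>I. ?C i)" .
  have "(2 powi (- p)) ^ CARD('n) = measure lebesgue ?B"
    by (rule measure_cube_cart(2)[symmetric]) simp
  also have "\<dots> \<le> measure lebesgue (\<Union>i\<in>I. ?C i)"
    using sub by (intro measure_mono_fmeasurable fmeasurable.finite_UN[OF \<open>finite I\<close>]) auto
  also have "\<dots> \<le> (\<Sum>i\<in>I. measure lebesgue (?C i))"
    using \<open>finite I\<close> by (intro measure_UNION_le) auto
  also have "\<dots> = (\<Sum>i\<in>I. (2 powi (- a i)) ^ CARD('n))"
    by (intro sum.cong refl measure_cube_cart(1)) simp
  finally show False using less by simp
qed

text \<open>For positive \<open>r\<close> this is the largest \<open>a\<close> with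
  \<open>r \<le> 2 powi (- a)\<close>, that is, rounding \<open>r\<close> up to a dyadic
  side.\<close>

definition dyadic_exponent :: "real \<Rightarrow> int" where
  "dyadic_exponent r = \<lfloor>- log 2 r\<rfloor>"

lemma dyadic_exponent_bounds:
  assumes "0 < r"
  shows "r \<le> 2 powi (- dyadic_exponent r)" and "2 powi (- dyadic_exponent r) < 2 * r"
proof -
  have eq: "(2::real) powi z = 2 powr z" for z
    by (simp add: powr_real_of_int')
  have "r = 2 powr (log 2 r)" using assms by simp
  also have "\<dots> \<le> 2 powr (- dyadic_exponent r)"
    unfolding dyadic_exponent_def by (intro powr_mono) linarith+
  finally show "r \<le> 2 powi (- dyadic_exponent r)" by (simp add: eq)
  have "2 powr (- dyadic_exponent r) < 2 powr (1 + log 2 r)"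
    unfolding dyadic_exponent_def by (intro powr_less_mono) linarith+
  also have "\<dots> = 2 * r" using assms by (simp add: powr_add)
  finally show "2 powi (- dyadic_exponent r) < 2 * r" by (simp add: eq)
qed

lemma dyadic_exponent_antimono:
  "0 < r \<Longrightarrow> r \<le> s \<Longrightarrow> dyadic_exponent s \<le> dyadic_exponent r"
  unfolding dyadic_exponent_def by (intro floor_mono) simp

lemma dyadic_exponent_powi: "dyadic_exponent (2 powi (- a)) = a"
proof -
  have "(2::real) powi (- a) = 2 powr (- a)"
    using powr_real_of_int'[of 2 "- a"] by simp
  then have "log 2 (2 powi (- a)) = log 2 (2 powr (- a))" by simp
  also have "\<dots> = - a" by (rule log_powr_cancel) auto
  finally show ?thesis by (simp add: dyadic_exponent_def)
qed

text \<open>These are the boxes that receive the cubes: every coordinate ranges over the dyadic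
  interval from \<open>2 powi (- p)\<close> to twice that value, so the boxes line up along the
  diagonal towards the origin. Being dyadic cells themselves, they contain every finer cell that
  meets them.\<close>

definition diagonal_cell :: "int \<Rightarrow> (real ^ 'n) set" where
  "diagonal_cell p = dyadic_cell p (vec (2 powi (- p)))"

lemma mem_diagonal_cell_iff:
  fixes y :: "real ^ 'n::finite"
  shows "y \<in> diagonal_cell p \<longleftrightarrow> (\<forall>i. 2 powi (- p) \<le> y $ i \<and> y $ i < 2 * 2 powi (- p))"
proof -
  have "cell_corner p (vec (2 powi (- p))) = (vec (2 powi (- p)) :: real ^ 'n)"
    by (simp add: cell_corner_def vec_eq_iff power_int_minus)
  then show ?thesis
    by (simp add: diagonal_cell_def mem_dyadic_cell_iff)
qed

lemma diagonal_cell_disjoint: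
  assumes "p \<noteq> q"
  shows "diagonal_cell p \<inter> diagonal_cell q = ({} :: (real ^ 'n::finite) set)"
proof -
  have "diagonal_cell p \<inter> diagonal_cell q = ({} :: (real ^ 'n) set)" if "p < q" for p q
  proof -
    have "(2::real) powi (1 - q) \<le> 2 powi (- p)"
      using that by (intro power_int_increasing) auto
    then have "2 * (2::real) powi (- q) \<le> 2 powi (- p)"
      by (simp add: power_int_diff power_int_minus field_simps)
    then have "y \<notin> diagonal_cell p" if "y \<in> diagonal_cell q" for y :: "real ^ 'n"
      using that unfolding mem_diagonal_cell_iff by (meson less_le_trans not_less order_trans)
    then show ?thesis by blast
  qed
  then show ?thesis using assms by (metis inf_commute linorder_neqE)
qed

lemma dyadic_cell_subset_diagonal_cell:
  assumes "x \<in> diagonal_cell p" "p \<le> a"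
  shows "dyadic_cell a x \<subseteq> diagonal_cell p"
  using assms dyadic_cell_mono[of p a x] by (auto simp: diagonal_cell_def dyadic_cell_def)

text \<open>
  Greedy packing: the tail sums decide which diagonal cell receives the \<open>j\<close>-th cube, and a point
  missed by the earlier cells is found by comparing volumes. Since the exponents increase, two cells
  are nested or disjoint, so the whole new cell avoids the earlier ones.
\<close>

lemma dyadic_packing:
  fixes a :: "nat \<Rightarrow> int"
  assumes "mono a"
    and summable: "summable (\<lambda>j. (2 powi (- a j) :: real) ^ CARD('n::finite))"
  obtains x :: "nat \<Rightarrow> real ^ 'n"
  where "disjoint_family (\<lambda>j. dyadic_cell (a j) (x j))" and "x \<longlonglongrightarrow> 0"
proof -
  define n where "n = CARD('n)"
  have "n > 0" by (simp add: n_def)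
  define v where "v j = (2 powi (- a j) :: real) ^ n" for j
  have v_pos: "0 < v j" for j by (simp add: v_def)
  have sv: "summable v" using summable by (simp add: v_def[abs_def] n_def)
  define T where "T j = (\<Sum>i. v (i + j))" for j
  have sum_le_T: "(\<Sum>i\<in>I. v i) \<le> T j" if "finite I" "\<And>i. i \<in> I \<Longrightarrow> j \<le> i" for I j
  proof -
    have "(\<Sum>i\<in>I. v i) = (\<Sum>i\<in>(\<lambda>i. i - j) ` I. v (i + j))"
      using that(2) by (subst sum.reindex) (auto simp: inj_on_diff_nat)
    also have "\<dots> \<le> T j"
      unfolding T_def using that(1) v_pos sv
      by (intro sum_le_suminf) (auto simp: summable_iff_shift less_imp_le)
    finally show ?thesis .
  qed
  have v_le_T: "v j \<le> T j" for j using sum_le_T[of "{j}" j] by simp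
  have T_pos: "0 < T j" for j using v_pos[of j] v_le_T[of j] by linarith
  \<comment> \<open>The side of the box for cube \<open>j\<close> is the smallest dyadic one whose
    volume is at least the tail \<open>T j\<close>.\<close>
  define p where "p j = dyadic_exponent (root n (T j))" for j
  have r_pos: "0 < root n (T j)" for j using T_pos \<open>n > 0\<close> by simp
  have T_le: "T j \<le> (2 powi (- p j)) ^ n" for j
  proof -
    have "T j = root n (T j) ^ n" using T_pos[of j] \<open>n > 0\<close> by (simp add: less_imp_le)
    also have "\<dots> \<le> (2 powi (- p j)) ^ n"
      unfolding p_def using dyadic_exponent_bounds(1)[OF r_pos] r_pos[of j]
      by (intro power_mono) auto
    finally show ?thesis .
  qed
  \<comment> \<open>The tail contains the term \<open>v j\<close>, so the box is at least as large
    as the cell to be placed in it.\<close>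
  have p_le_a: "p j \<le> a j" for j
  proof -
    have "2 powi (- a j) = root n (v j)"
      using \<open>n > 0\<close> by (simp add: v_def real_root_power_cancel)
    also have "\<dots> \<le> root n (T j)" using v_le_T \<open>n > 0\<close> by simp
    finally have "dyadic_exponent (root n (T j)) \<le> dyadic_exponent (2 powi (- a j))"
      by (intro dyadic_exponent_antimono) auto
    then show ?thesis by (simp add: p_def dyadic_exponent_powi)
  qed
  have "T \<longlonglongrightarrow> 0"
    unfolding T_def by (rule suminf_exist_split2[OF sv])
  then have "(\<lambda>j. root n (T j)) \<longlonglongrightarrow> root n 0"
    by (intro tendsto_intros)
  then have root_lim: "(\<lambda>j. root n (T j)) \<longlonglongrightarrow> 0" by simp

  have room: "\<exists>y \<in> diagonal_cell (p j). \<forall>i<j. y \<notin> dyadic_cell (a i) (f i)"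
    if f: "\<And>i. i < j \<Longrightarrow> f i \<in> diagonal_cell (p i)" for j and f :: "nat \<Rightarrow> real ^ 'n"
  proof -
    \<comment> \<open>Only earlier cells in the same box compete for space. If \<open>j0\<close> is
      the first index assigned to this box, the cells of \<open>I\<close> together with the new one
      have volume at most \<open>T j0\<close>, hence at most that of the box; leaving out the
      positive \<open>v j\<close> makes the inequality strict.\<close>
    define I where "I = {i. i < j \<and> p i = p j}"
    have "finite I" by (simp add: I_def)
    define j0 where "j0 = Min (insert j I)"
    have "j0 \<in> insert j I" unfolding j0_def using \<open>finite I\<close> by (intro Min_in) auto
    then have pj0: "p j0 = p j" by (auto simp: I_def)
    have "(\<Sum>i\<in>I. v i) < (\<Sum>i\<in>insert j I. v i)"
      using \<open>finite I\<close> v_pos[of j] by (simp add: I_def)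
    also have "\<dots> \<le> T j0"
      using \<open>finite I\<close> by (intro sum_le_T) (auto simp: j0_def)
    also have "\<dots> \<le> (2 powi (- p j)) ^ n" using T_le[of j0] pj0 by simp
    finally obtain y where y: "y \<in> diagonal_cell (p j)"
      "\<And>i. i \<in> I \<Longrightarrow> y \<notin> dyadic_cell (a i) (f i)"
      using dyadic_cell_not_covered[OF \<open>finite I\<close>, of a "p j"]
      unfolding v_def n_def diagonal_cell_def by metis
    have "y \<notin> dyadic_cell (a i) (f i)" if "i < j" for i
    proof (cases "p i = p j")
      case True
      then show ?thesis using y that by (auto simp: I_def)
    next
      case False
      then show ?thesis
        using y(1) diagonal_cell_disjoint[OF False]
          dyadic_cell_subset_diagonal_cell[OF f[OF that] p_le_a[of i]] by blast
    qed
    then show ?thesis using y(1) by blast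
  qed
  obtain x :: "nat \<Rightarrow> real ^ 'n" where
    x: "x j \<in> diagonal_cell (p j)" "\<And>i. i < j \<Longrightarrow> x j \<notin> dyadic_cell (a i) (x i)" for j
  proof -
    define P where "P f j y \<longleftrightarrow> y \<in> diagonal_cell (p j) \<and> (\<forall>i<j. y \<notin> dyadic_cell (a i) (f i))"
      for f :: "nat \<Rightarrow> real ^ 'n" and j y
    have "\<exists>x. \<forall>j. P x j (x j)"
    \<comment> \<open>The remaining side condition says that \<open>P f j\<close> depends only on
      the values of \<open>f\<close> below \<open>j\<close>.\<close>
    proof (rule dependent_wf_choice[OF wf_less_than])
      fix j and f :: "nat \<Rightarrow> real ^ 'n"
      assume "\<And>i. (i, j) \<in> less_than \<Longrightarrow> P f i (f i)"
      then show "\<exists>y. P f j y"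
        using room[of j f] unfolding P_def by auto
    qed (simp add: P_def)
    then obtain x where "\<And>j. P x j (x j)" by blast
    then show ?thesis using that unfolding P_def by blast
  qed
  have disj: "dyadic_cell (a i) (x i) \<inter> dyadic_cell (a j) (x j) = {}" if "i < j" for i j
  proof (rule ccontr)
    assume "\<not> ?thesis"
    then obtain y where "y \<in> dyadic_cell (a i) (x i)" "y \<in> dyadic_cell (a j) (x j)" by blast
    moreover have "a i \<le> a j" using \<open>mono a\<close> that by (simp add: monoD)
    ultimately have "x j \<in> dyadic_cell (a i) (x i)"
      using dyadic_cell_mono[of "a i" "a j" "x j"] by (auto simp: dyadic_cell_def)
    then show False using x(2)[OF that] by simp
  qed
  have "disjoint_family (\<lambda>j. dyadic_cell (a j) (x j))"
    unfolding disjoint_family_on_def using disj by (metis Int_commute linorder_neqE_nat)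
  moreover have "x \<longlonglongrightarrow> 0"
  proof (rule vec_tendstoI)
    fix i
    \<comment> \<open>A coordinate in the box is below twice its side, and rounding up to a dyadic
      side costs less than another factor 2.\<close>
    have bound: "norm (x j $ i) \<le> 4 * root n (T j)" for j
      using x(1)[of j] dyadic_exponent_bounds(2)[OF r_pos[of j]] r_pos[of j]
      unfolding mem_diagonal_cell_iff p_def real_norm_def
      by (smt (verit) zero_less_power_int)
    have "(\<lambda>j. 4 * root n (T j)) \<longlonglongrightarrow> 0"
      using tendsto_mult_right_zero[OF root_lim] by simp
    then show "(\<lambda>j. x j $ i) \<longlonglongrightarrow> 0 $ i"
      unfolding zero_index by (rule Lim_null_comparison[OF always_eventually[OF allI[OF bound]]])
  qed
  ultimately show ?thesis by (rule that)
qed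

subsection \<open>Connectedness of the complement\<close>

text \<open>Each shell \<open>U j - G j\<close> is connected, so a separation puts it entirely on
  one side; giving the whole patch \<open>U j\<close> to that side extends the separation to
  \<open>X\<close>. Nonempty shells prevent a patch from going to both sides.\<close>

lemma connected_diff_Union_patches:
  fixes X :: "'a::topological_space set" and G U :: "'i \<Rightarrow> 'a set"
  assumes "connected X" and op: "open (X - (\<Union>j\<in>J. G j))"
    and U: "\<And>j. j \<in> J \<Longrightarrow> open (U j)" "\<And>j. j \<in> J \<Longrightarrow> U j \<subseteq> X"
    and disj: "disjoint_family_on U J"
    and G: "\<And>j. j \<in> J \<Longrightarrow> G j \<subseteq> U j"
    and con: "\<And>j. j \<in> J \<Longrightarrow> connected (U j - G j)"
    and ne: "\<And>j. j \<in> J \<Longrightarrow> U j - G j \<noteq> {}"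
  shows "connected (X - (\<Union>j\<in>J. G j))"
proof -
  define S where "S = X - (\<Union>j\<in>J. G j)"
  have SG: "x \<notin> G j" if "x \<in> S" "j \<in> J" for x j
    using that by (auto simp: S_def)
  have shell: "U j - G j \<subseteq> S" if "j \<in> J" for j
  proof
    fix x assume x: "x \<in> U j - G j"
    have "x \<notin> G i" if "i \<in> J" for i
      using x G[OF that] disjoint_family_onD[OF disj that \<open>j \<in> J\<close>] by (cases "i = j") auto
    then show "x \<in> S" using x U(2)[OF that] by (auto simp: S_def)
  qed
  have "connected S"
  proof (rule connectedI)
    fix A B
    assume AB: "open A" "open B" "A \<inter> S \<noteq> {}" "B \<inter> S \<noteq> {}" "A \<inter> B \<inter> S = {}" "S \<subseteq> A \<union> B"
    \<comment> \<open>The side \<open>C\<close> with the missing sets \<open>G j\<close> filled in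
      wherever the shell lies in \<open>C\<close>. It is open because \<open>S\<close> and the
      patches are.\<close>
    define P where "P C = (C \<inter> S) \<union> (\<Union>j\<in>{j \<in> J. U j - G j \<subseteq> C}. U j)" for C
    have P_iff: "x \<in> P C \<longleftrightarrow> x \<in> C" if "x \<in> S" for x C
      using that SG[OF that] by (auto simp: P_def)
    have "open (P A)" "open (P B)"
      unfolding P_def using AB(1,2) op U(1) by (auto simp flip: S_def)
    moreover have "P A \<inter> P B \<inter> X = {}"
    proof (rule ccontr)
      assume "P A \<inter> P B \<inter> X \<noteq> {}"
      then obtain x where x: "x \<in> P A" "x \<in> P B" by blast
      have "x \<notin> S" using x P_iff[of x] AB(5) by blast
      then obtain i j where i: "i \<in> J" "U i - G i \<subseteq> A" "x \<in> U i"
        and j: "j \<in> J" "U j - G j \<subseteq> B" "x \<in> U j"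
        using x by (auto simp: P_def)
      have "i = j" using disjoint_family_onD[OF disj i(1) j(1)] i(3) j(3) by blast
      obtain y where "y \<in> U i - G i" using ne[OF i(1)] by blast
      then have "y \<in> A \<inter> B \<inter> S" using i(2) j(2) shell[OF i(1)] \<open>i = j\<close> by blast
      then show False using AB(5) by blast
    qed
    moreover have "X \<subseteq> P A \<union> P B"
    proof
      fix x assume "x \<in> X"
      show "x \<in> P A \<union> P B"
      proof (cases "x \<in> S")
        case True
        then show ?thesis using AB(6) P_iff[OF True] by blast
      next
        case False
        then obtain j where j: "j \<in> J" "x \<in> U j" using \<open>x \<in> X\<close> G by (auto simp: S_def)
        have "A \<inter> B \<inter> (U j - G j) = {}" "U j - G j \<subseteq> A \<union> B"
          using shell[OF j(1)] AB(5,6) by blast+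
        then have "A \<inter> (U j - G j) = {} \<or> B \<inter> (U j - G j) = {}"
          by (rule connectedD[OF con[OF j(1)] AB(1,2)])
        then have "U j - G j \<subseteq> A \<or> U j - G j \<subseteq> B"
          using \<open>U j - G j \<subseteq> A \<union> B\<close> by blast
        then show ?thesis using j by (auto simp: P_def)
      qed
    qed
    ultimately have "P A \<inter> X = {} \<or> P B \<inter> X = {}"
      by (intro connectedD[OF \<open>connected X\<close>])
    then show False using AB(3,4) P_iff S_def by blast
  qed
  then show ?thesis by (simp add: S_def)
qed

text \<open>Away from \<open>x\<close> the family is locally finite: all but finitely many
  \<open>G j\<close> lie in a given ball around \<open>x\<close>, and the rest form a finite union
  of closed sets.\<close>

lemma closure_Union_insert_limit:
  fixes x :: "'a::metric_space"
  assumes closed: "\<And>j::nat. closed (G j)" and lim: "t \<longlonglongrightarrow> x"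
    and ne: "\<And>j. t j \<in> G j"
    and small: "\<And>j y. y \<in> G j \<Longrightarrow> dist y (t j) \<le> d j" and d: "d \<longlonglongrightarrow> 0"
  shows "closure (\<Union>j. G j) = insert x (\<Union>j. G j)"
proof
  show "insert x (\<Union>j. G j) \<subseteq> closure (\<Union>j. G j)"
  proof -
    have "x \<in> closure (\<Union>j. G j)"
      unfolding closure_sequential using ne lim by (intro exI[of _ t]) auto
    then show ?thesis using closure_subset[of "\<Union>j. G j"] by simp
  qed
  show "closure (\<Union>j. G j) \<subseteq> insert x (\<Union>j. G j)"
  proof
    fix y assume y: "y \<in> closure (\<Union>j. G j)"
    show "y \<in> insert x (\<Union>j. G j)"
    proof (cases "y = x")
      case False
      define e where "e = dist y x / 2"
      have "e > 0" using False by (simp add: e_def)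
      have "(\<lambda>j. d j + dist (t j) x) \<longlonglongrightarrow> 0 + 0"
        by (intro tendsto_add d lim[THEN tendsto_dist_iff[THEN iffD1]])
      then have "eventually (\<lambda>j. d j + dist (t j) x < e) sequentially"
        using \<open>e > 0\<close> by (intro order_tendstoD(2)) auto
      then obtain J where J: "\<And>j. j \<ge> J \<Longrightarrow> d j + dist (t j) x < e"
        unfolding eventually_sequentially by blast
      have "G j \<subseteq> cball x e" if "j \<ge> J" for j
      proof
        fix z assume "z \<in> G j"
        then show "z \<in> cball x e"
          using J[OF that] small[of z j] dist_triangle[of z x "t j"] by (simp add: dist_commute)
      qed
      then have "G j \<subseteq> (\<Union>j<J. G j) \<union> cball x e" for j
        by (cases "j < J") (auto simp: not_less)
      then have "(\<Union>j. G j) \<subseteq> (\<Union>j<J. G j) \<union> cball x e" by (rule UN_least)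
      then have "closure (\<Union>j. G j) \<subseteq> (\<Union>j<J. G j) \<union> cball x e"
        by (intro closure_minimal closed_Un closed_UN) (auto intro: closed)
      moreover have "y \<notin> cball x e"
        using \<open>e > 0\<close> by (simp add: e_def dist_commute)
      ultimately show ?thesis using y by auto
    qed simp
  qed
qed

section \<open>Geometry of a single perforated cube\<close>

lemma unit_cube_eq_box: "unit_cube = (box 0 1 :: (real ^ 'n::finite) set)"
  by (auto simp: unit_cube_def mem_box_cart)

lemma frontier_unit_cube: "frontier (unit_cube :: (real ^ 'n::finite) set) = cbox 0 1 - unit_cube"
proof -
  have "vec (1 / 2) \<in> (box 0 1 :: (real ^ 'n) set)" by (simp add: mem_box_cart)
  then show ?thesis
    unfolding unit_cube_eq_box frontier_box by auto
qed

lemma closure_unit_cube: "closure (unit_cube :: (real ^ 'n::finite) set) = cbox 0 1"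
proof -
  have "vec (1 / 2) \<in> (box 0 1 :: (real ^ 'n) set)" by (simp add: mem_box_cart)
  then show ?thesis
    unfolding unit_cube_eq_box by (intro closure_box) auto
qed

text \<open>The hole thickened to an open convex set that meets both the cube and its exterior.\<close>

definition hole_passage :: "'n \<Rightarrow> real \<Rightarrow> (real ^ 'n) set" where
  "hole_passage k \<epsilon> = {x. x $ k < 1 \<and> (\<forall>i. i \<noteq> k \<longrightarrow> 0 < x $ i \<and> x $ i < \<epsilon>)}"

text \<open>The passage reaches no face other than the perforated one: a point of it with positive
  coordinate \<open>k\<close> that belongs to the closed cube has all coordinates strictly between 0
  and 1. Subtracting an open convex set instead of the flat hole yields both closedness and a
  connecting piece.\<close>

lemma perforated_boundary_eq:
  fixes k :: "'n::finite"
  assumes "\<epsilon> < 1"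
  shows "perforated_boundary k \<epsilon> = frontier unit_cube - hole_passage k \<epsilon>"
proof -
  have "x $ k = 0" if "x \<in> frontier unit_cube" "x \<in> hole_passage k \<epsilon>" for x :: "real ^ 'n"
  proof (rule ccontr)
    assume "x $ k \<noteq> 0"
    moreover have "0 \<le> x $ k"
      using that(1) by (auto simp: frontier_unit_cube mem_box_cart)
    ultimately have "x \<in> unit_cube"
      using that(2) assms unfolding hole_passage_def unit_cube_def
      by (smt (verit) mem_Collect_eq)
    then show False using that(1) by (simp add: frontier_unit_cube)
  qed
  then show ?thesis
    by (auto simp: perforated_boundary_def hole_passage_def)
qed

lemma closed_perforated_boundary:
  fixes k :: "'n::finite"
  assumes "\<epsilon> < 1"
  shows "closed (perforated_boundary k \<epsilon>)"
proof -
  have "hole_passage k \<epsilon> =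
      {x. x $ k < 1} \<inter> (\<Inter>i\<in>{i. i \<noteq> k}. {x. 0 < x $ i} \<inter> {x. x $ i < \<epsilon>})"
    by (auto simp: hole_passage_def)
  moreover have "open \<dots>"
    by (intro open_Int open_INT ballI open_Collect_less continuous_intros finite)
  ultimately have "open (hole_passage k \<epsilon>)" by simp
  then show ?thesis
    unfolding perforated_boundary_eq[OF assms] by (intro closed_Diff) auto
qed

lemma ex_other_index:
  fixes k :: "'n::finite"
  assumes "CARD('n) \<ge> 2"
  shows "\<exists>i. i \<noteq> k"
  using assms by (metis UNIV_I card_le_Suc0_iff_eq finite not_less_eq_eq numeral_2_eq_2)

text \<open>A second coordinate excludes the corner 0 from the hole. The corner serves as marker:
  after scaling and shifting it becomes the translation vector, which thus lies in the corresponding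
  boundary.\<close>

lemma zero_in_perforated_boundary:
  fixes k :: "'n::finite"
  assumes "CARD('n) \<ge> 2"
  shows "0 \<in> perforated_boundary k \<epsilon>"
proof -
  obtain i where "i \<noteq> k"
    using ex_other_index[OF assms] by blast
  then show ?thesis
    by (auto simp: perforated_boundary_def frontier_unit_cube) (simp_all add: mem_box_cart unit_cube_eq_box)
qed

text \<open>The unit cube with a margin of 1/2 on all sides; its side 2 is the factor in
  \<open>2 * L j\<close> in the packing below.\<close>

definition cube_patch :: "(real ^ 'n) set" where
  "cube_patch = {x. \<forall>i. - (1 / 2) < x $ i \<and> x $ i < 3 / 2}"

lemma cbox_subset_cube_patch: "cbox 0 1 \<subseteq> (cube_patch :: (real ^ 'n::finite) set)"
proof
  fix x :: "real ^ 'n"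
  assume "x \<in> cbox 0 1"
  then have "0 \<le> x $ i" "x $ i \<le> 1" for i by (simp_all add: mem_box_cart)
  moreover have "- (1 / 2) < u \<and> u < 3 / 2" if "0 \<le> u" "u \<le> 1" for u :: real
    using that by simp
  ultimately show "x \<in> cube_patch" unfolding cube_patch_def by blast
qed

lemma open_cube_patch: "open (cube_patch :: (real ^ 'n::finite) set)"
proof -
  have "cube_patch = (box (vec (- (1 / 2))) (vec (3 / 2)) :: (real ^ 'n) set)"
    by (auto simp: cube_patch_def mem_box_cart)
  then show ?thesis by (metis open_box)
qed

text \<open>The predicates \<open>P\<close> and \<open>Q\<close> switch single bounds on and off, so
  that half-spaces, \<open>cube_patch\<close> and \<open>hole_passage\<close> are all
  instances.\<close>

lemma convex_coordinate_bounds: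
  "convex {x :: real ^ 'n::finite. \<forall>i. (P i \<longrightarrow> a i < x $ i) \<and> (Q i \<longrightarrow> x $ i < b i)}"
proof -
  have "{x :: real ^ 'n. \<forall>i. (P i \<longrightarrow> a i < x $ i) \<and> (Q i \<longrightarrow> x $ i < b i)} =
      (\<Inter>i\<in>{i. P i}. {x. a i < x \<bullet> axis i 1}) \<inter> (\<Inter>i\<in>{i. Q i}. {x. x \<bullet> axis i 1 < b i})"
    by (auto simp: inner_axis)
  then show ?thesis
    by (auto simp: inner_commute[of _ "axis _ _"]
        intro!: convex_Int convex_INT convex_halfspace_lt convex_halfspace_gt)
qed

text \<open>The set is a union of convex pieces: the slabs \<open>lo i\<close> and
  \<open>hi i\<close> of the margin, the passage \<open>H\<close> and the open cube. Every slab
  except \<open>hi k\<close> is chained to \<open>lo k\<close>. The opposite slabs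
  \<open>lo k\<close> and \<open>hi k\<close> do not meet, so \<open>hi k\<close> is reached through
  \<open>lo i0\<close> with \<open>i0 \<noteq> k\<close>; \<open>H\<close> joins \<open>lo k\<close>
  to the open cube.\<close>

lemma connected_cube_patch_diff:
  fixes k :: "'n::finite"
  assumes card: "CARD('n) \<ge> 2" and \<epsilon>: "0 < \<epsilon>" "\<epsilon> < 1"
  shows "connected (cube_patch - perforated_boundary k \<epsilon>)"
proof -
  define lo hi :: "'n \<Rightarrow> (real ^ 'n) set"
    where "lo i = cube_patch \<inter> {x. x $ i < 0}" and "hi i = cube_patch \<inter> {x. 1 < x $ i}" for i
  define H where "H = cube_patch \<inter> hole_passage k \<epsilon>"
  have half: "convex {x :: real ^ 'n. x $ i < b}" "convex {x :: real ^ 'n. b < x $ i}" for i b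
    using convex_coordinate_bounds[of "\<lambda>_. False" _ "\<lambda>j. j = i" "\<lambda>_. b"]
      convex_coordinate_bounds[of "\<lambda>j. j = i" "\<lambda>_. b" "\<lambda>_. False"] by simp_all
  have cp: "convex (cube_patch :: (real ^ 'n) set)"
    unfolding cube_patch_def
    using convex_coordinate_bounds[of "\<lambda>_. True" "\<lambda>_. - (1 / 2)" "\<lambda>_. True" "\<lambda>_. 3 / 2"] by simp
  have conv: "convex (lo i)" "convex (hi i)" for i
    unfolding lo_def hi_def by (intro convex_Int cp half)+
  have "convex (hole_passage k \<epsilon>)"
  proof -
    have "hole_passage k \<epsilon> =
      {x. \<forall>i. (i \<noteq> k \<longrightarrow> 0 < x $ i) \<and> (True \<longrightarrow> x $ i < (if i = k then 1 else \<epsilon>))}"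
      by (auto simp: hole_passage_def)
    also have "convex \<dots>" by (rule convex_coordinate_bounds)
    finally show ?thesis .
  qed
  then have convH: "convex H" unfolding H_def by (intro convex_Int cp)
  have convO: "convex (unit_cube :: (real ^ 'n) set)" by (simp add: unit_cube_eq_box)

  obtain i0 where i0: "i0 \<noteq> k"
    using ex_other_index[OF card] by blast
  have eq: "cube_patch - perforated_boundary k \<epsilon> =
      (\<Union>i\<in>{i. i \<noteq> k}. lo i \<union> lo k \<union> hi i) \<union> hi k \<union> H \<union> unit_cube"
  proof -
    have R: "(\<Union>i\<in>{i. i \<noteq> k}. lo i \<union> lo k \<union> hi i) \<union> hi k = (\<Union>i. lo i \<union> hi i)"
      using i0 by auto metis
    \<comment> \<open>Pure set algebra, to be read with \<open>D\<close> the patch, \<open>K\<close>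
      the closed cube, \<open>Q\<close> the open cube, \<open>h\<close> the passage and
      \<open>V\<close> the union of the slabs.\<close>
    have set_eq: "D - (K - Q - h) = V \<union> (D \<inter> h) \<union> Q"
      if "Q \<subseteq> D" "V \<inter> K = {}" "V \<subseteq> D" "D - K \<subseteq> V" for D K Q h V :: "(real ^ 'n) set"
      using that by blast
    show ?thesis
      unfolding R perforated_boundary_eq[OF \<epsilon>(2)] frontier_unit_cube H_def
    proof (rule set_eq)
      show "unit_cube \<subseteq> (cube_patch :: (real ^ 'n) set)"
        using cbox_subset_cube_patch box_subset_cbox[of 0 1] by (auto simp: unit_cube_eq_box)
      show "(\<Union>i. lo i \<union> hi i) \<inter> cbox 0 1 = {}"
        by (auto simp: lo_def hi_def mem_box_cart not_less[symmetric])
      show "(\<Union>i. lo i \<union> hi i) \<subseteq> cube_patch"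
        by (auto simp: lo_def hi_def)
      show "cube_patch - cbox 0 1 \<subseteq> (\<Union>i. lo i \<union> hi i)"
        by (force simp: lo_def hi_def mem_box_cart not_le)
    qed
  qed
  have meet: "S \<inter> T \<noteq> {}" if "x \<in> S" "x \<in> T" for S T and x :: "real ^ 'n" using that by blast
  have W: "connected (\<Union>i\<in>{i. i \<noteq> k}. lo i \<union> lo k \<union> hi i)"
  proof (rule connected_Union)
    fix S assume "S \<in> (\<lambda>i. lo i \<union> lo k \<union> hi i) ` {i. i \<noteq> k}"
    then obtain i where i: "i \<noteq> k" "S = lo i \<union> lo k \<union> hi i" by blast
    have "lo i \<inter> lo k \<noteq> {}"
      by (rule meet[of "vec (- (1 / 4))"]) (auto simp: lo_def cube_patch_def)
    moreover have "(lo i \<union> lo k) \<inter> hi i \<noteq> {}"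
      by (rule meet[of "\<chi> j. if j = i then 5 / 4 else - (1 / 4)"])
        (use i in \<open>auto simp: lo_def hi_def cube_patch_def\<close>)
    ultimately show "connected S"
      unfolding i(2) by (intro connected_Un convex_connected conv) auto
  next
    have "vec (- (1 / 4)) \<in> lo k" by (auto simp: lo_def cube_patch_def)
    then have "vec (- (1 / 4)) \<in> \<Inter> ((\<lambda>i. lo i \<union> lo k \<union> hi i) ` {i. i \<noteq> k})" by blast
    then show "\<Inter> ((\<lambda>i. lo i \<union> lo k \<union> hi i) ` {i. i \<noteq> k}) \<noteq> {}" by blast
  qed
  \<comment> \<open>The values \<open>- (1 / 4)\<close> and \<open>5 / 4\<close> are midpoints of
    the margin below and above the cube; \<open>\<epsilon> / 2\<close> is the centre of the
    hole.\<close>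
  have "(\<chi> j. if j = k then 5 / 4 else - (1 / 4)) \<in> lo i0 \<inter> hi k"
    using i0 by (auto simp: lo_def hi_def cube_patch_def)
  moreover have "(\<chi> j. if j = k then - (1 / 4) else \<epsilon> / 2) \<in> lo k \<inter> H"
    using \<epsilon> by (auto simp: lo_def H_def hole_passage_def cube_patch_def)
  moreover have "(\<chi> j. if j = k then 1 / 2 else \<epsilon> / 2) \<in> H \<inter> unit_cube"
    using \<epsilon> by (auto simp: H_def hole_passage_def cube_patch_def unit_cube_def)
  ultimately show ?thesis
    unfolding eq using i0
    by (intro connected_Un W convex_connected conv convH convO) blast+
qed

section \<open>Scaled and translated copies\<close>

lemma mem_scale_shift_iff:
  assumes "l > 0"
  shows "x \<in> scale_shift l S t \<longleftrightarrow> (x - t) /\<^sub>R l \<in> S"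
proof
  assume "(x - t) /\<^sub>R l \<in> S"
  moreover have "x = l *\<^sub>R ((x - t) /\<^sub>R l) + t" using assms by simp
  ultimately show "x \<in> scale_shift l S t" unfolding scale_shift_def by (rule rev_image_eqI)
qed (use assms in \<open>auto simp: scale_shift_def\<close>)

lemma open_scale_shift:
  assumes "l > 0" "open S"
  shows "open (scale_shift l S t)"
proof -
  have "scale_shift l S t = (\<lambda>x. (x - t) /\<^sub>R l) -` S"
    using mem_scale_shift_iff[OF assms(1)] by blast
  then show ?thesis using assms(2) by (auto intro!: open_vimage continuous_intros)
qed

lemma closed_scale_shift:
  assumes "l > 0" "closed S"
  shows "closed (scale_shift l S t)"
proof -
  have "scale_shift l S t = (\<lambda>x. (x - t) /\<^sub>R l) -` S"
    using mem_scale_shift_iff[OF assms(1)] by blast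
  then show ?thesis using assms(2) by (auto intro!: closed_vimage continuous_intros)
qed

lemma connected_scale_shift: "connected S \<Longrightarrow> connected (scale_shift l S t)"
  unfolding scale_shift_def by (intro connected_continuous_image continuous_intros)

lemma scale_shift_mono: "S \<subseteq> T \<Longrightarrow> scale_shift l S t \<subseteq> scale_shift l T t"
  by (auto simp: scale_shift_def)

lemma scale_shift_Diff:
  "l > 0 \<Longrightarrow> scale_shift l (S - T) t = scale_shift l S t - scale_shift l T t"
  by (auto simp: mem_scale_shift_iff)

lemma closure_scale_shift: "closure (scale_shift l S t) = scale_shift l (closure S) t"
proof -
  have "scale_shift l S t = (+) t ` (*\<^sub>R) l ` S" for S
    by (simp add: scale_shift_def image_image add.commute)
  then show ?thesis by (simp add: closure_translation closure_scaleR)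
qed

section \<open>Placing the cubes and assembling the domain\<close>

lemma shifted_cubes_packing:
  fixes L :: "nat \<Rightarrow> real"
  assumes pos: "\<And>j. 0 < L j" and "decseq L"
    and summable: "summable (\<lambda>j. L j ^ CARD('n::finite))"
  obtains t :: "nat \<Rightarrow> real ^ 'n"
  where "disjoint_family (\<lambda>j. scale_shift (L j) cube_patch (t j))" and "t \<longlonglongrightarrow> 0"
proof -
  define a where "a j = dyadic_exponent (2 * L j)" for j
  have a: "2 * L j \<le> 2 powi (- a j)" "2 powi (- a j) < 4 * L j" for j
    using dyadic_exponent_bounds[of "2 * L j"] pos[of j] by (simp_all add: a_def)
  have "mono a"
    unfolding a_def using pos \<open>decseq L\<close>
    by (intro monoI dyadic_exponent_antimono) (auto simp: decseq_def)
  moreover have "summable (\<lambda>j. (2 powi (- a j) :: real) ^ CARD('n))"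
  proof (rule summable_comparison_test')
    show "summable (\<lambda>j. 4 ^ CARD('n) * L j ^ CARD('n))"
      by (intro summable_mult summable)
    show "norm ((2 powi (- a j) :: real) ^ CARD('n)) \<le> 4 ^ CARD('n) * L j ^ CARD('n)"
      if "0 \<le> j" for j
    proof -
      have "(2 powi (- a j)) ^ CARD('n) \<le> (4 * L j) ^ CARD('n)"
        using a(2)[of j] by (intro power_mono) (auto intro: less_imp_le)
      then show ?thesis by (simp add: power_mult_distrib)
    qed
  qed
  ultimately obtain x :: "nat \<Rightarrow> real ^ 'n" where
    disj: "disjoint_family (\<lambda>j. dyadic_cell (a j) (x j))" and "x \<longlonglongrightarrow> 0"
    by (rule dyadic_packing)
  \<comment> \<open>The patch extends to \<open>- (1 / 2)\<close>, so the offset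
    \<open>L j / 2\<close> puts its lower corner at that of the cell.\<close>
  define t where "t j = cell_corner (a j) (x j) + vec (L j / 2)" for j
  have sub: "scale_shift (L j) cube_patch (t j) \<subseteq> dyadic_cell (a j) (x j)" for j
  proof
    fix y assume "y \<in> scale_shift (L j) cube_patch (t j)"
    then obtain z where z: "z \<in> cube_patch" "y = L j *\<^sub>R z + t j"
      unfolding scale_shift_def by blast
    have "cell_corner (a j) (x j) $ i \<le> y $ i \<and> y $ i < cell_corner (a j) (x j) $ i + 2 powi (- a j)"
      for i
    proof -
      have "- (1 / 2) < z $ i" "z $ i < 3 / 2" using z(1) by (simp_all add: cube_patch_def)
      then have "L j * - (1 / 2) < L j * z $ i" "L j * z $ i < L j * (3 / 2)"
        using pos[of j] by (simp_all only: mult_less_cancel_left_pos)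
      then show ?thesis using a(1)[of j] by (simp add: z(2) t_def)
    qed
    then show "y \<in> dyadic_cell (a j) (x j)" by (simp add: mem_dyadic_cell_iff)
  qed
  have "disjoint_family (\<lambda>j. scale_shift (L j) cube_patch (t j))"
    using disj sub unfolding disjoint_family_on_def by blast
  moreover have "t \<longlonglongrightarrow> 0"
  proof (rule vec_tendstoI)
    fix i
    have "L \<longlonglongrightarrow> 0" by (rule tendsto_zero_of_summable_power) (use pos summable in \<open>auto intro: less_imp_le\<close>)
    moreover have "(\<lambda>j. x j $ i) \<longlonglongrightarrow> 0"
      using tendsto_vec_nth[OF \<open>x \<longlonglongrightarrow> 0\<close>, of i] by simp
    ultimately have "(\<lambda>j. \<bar>x j $ i\<bar> + 5 * L j) \<longlonglongrightarrow> \<bar>0\<bar> + 5 * 0"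
      by (intro tendsto_intros)
    then have lim: "(\<lambda>j. \<bar>x j $ i\<bar> + 5 * L j) \<longlonglongrightarrow> 0" by simp
    \<comment> \<open>The corner is within \<open>4 * L j\<close> of \<open>x j\<close> in each
      coordinate, and the offset adds \<open>L j / 2\<close>; 5 covers both.\<close>
    have bound: "norm (t j $ i) \<le> \<bar>x j $ i\<bar> + 5 * L j" for j
    proof -
      have "cell_corner (a j) (x j) $ i \<le> x j $ i"
        "x j $ i < cell_corner (a j) (x j) $ i + 2 powi (- a j)"
        using mem_dyadic_cell_self[of "x j" "a j"] by (simp_all add: mem_dyadic_cell_iff)
      then show ?thesis using a(2)[of j] pos[of j] by (simp add: t_def)
    qed
    show "(\<lambda>j. t j $ i) \<longlonglongrightarrow> 0 $ i"
      unfolding zero_index by (rule Lim_null_comparison[OF always_eventually[OF allI[OF bound]] lim])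
  qed
  ultimately show ?thesis by (rule that)
qed

lemma perforated_cubes_packing:
  fixes k :: "'n::finite" and E L :: "nat \<Rightarrow> real"
  assumes card: "CARD('n) \<ge> 2" and E: "\<And>j. 0 < E j" "\<And>j. E j < 1"
    and pos: "\<And>j. 0 < L j" and "decseq L"
    and summable: "summable (\<lambda>j. L j ^ CARD('n))"
  obtains t :: "nat \<Rightarrow> real ^ 'n" and x_inf
  where "disjoint_family (\<lambda>j. closure (scale_shift (L j) unit_cube (t j)))"
    and "disjoint_family (\<lambda>j. scale_shift (L j) (perforated_boundary k (E j)) (t j))"
    and "bounded (\<Union>j. scale_shift (L j) unit_cube (t j))"
    and "closure (\<Union>j. scale_shift (L j) (perforated_boundary k (E j)) (t j))
      \<subseteq> frontier (\<Union>j. scale_shift (L j) unit_cube (t j))"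
    and "compact (closure (\<Union>j. scale_shift (L j) (perforated_boundary k (E j)) (t j)))"
    and "connected (UNIV - closure (\<Union>j. scale_shift (L j) (perforated_boundary k (E j)) (t j)))"
    and "closure (\<Union>j. scale_shift (L j) (perforated_boundary k (E j)) (t j)) =
      {x_inf} \<union> (\<Union>j. scale_shift (L j) (perforated_boundary k (E j)) (t j))"
proof -
  obtain t :: "nat \<Rightarrow> real ^ 'n" where
    disj: "disjoint_family (\<lambda>j. scale_shift (L j) cube_patch (t j))" and "t \<longlonglongrightarrow> 0"
    using shifted_cubes_packing[OF pos \<open>decseq L\<close> summable] by blast
  define U where "U j = scale_shift (L j) cube_patch (t j)" for j
  define K where "K j = scale_shift (L j) (cbox 0 1) (t j)" for j
  define C where "C j = scale_shift (L j) unit_cube (t j)" for j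
  define G where "G j = scale_shift (L j) (perforated_boundary k (E j)) (t j)" for j
  have disjU: "disjoint_family U" using disj by (simp add: U_def[abs_def])
  have "L \<longlonglongrightarrow> 0" by (rule tendsto_zero_of_summable_power) (use pos summable in \<open>auto intro: less_imp_le\<close>)
  have closure_C: "closure (C j) = K j" for j
    by (simp add: C_def K_def closure_scale_shift closure_unit_cube)
  have KU: "K j \<subseteq> U j" for j
    unfolding K_def U_def by (intro scale_shift_mono cbox_subset_cube_patch)
  have GK: "G j \<subseteq> K j - C j" for j
    unfolding G_def K_def C_def scale_shift_Diff[OF pos, symmetric]
    by (intro scale_shift_mono) (auto simp: perforated_boundary_def frontier_unit_cube)
  have openU: "open (U j)" and openC: "open (C j)" and closedG: "closed (G j)" for j
    unfolding U_def C_def G_def using pos E(2)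
    by (simp_all add: open_scale_shift closed_scale_shift open_cube_patch unit_cube_eq_box open_box
        closed_perforated_boundary)
  have tG: "t j \<in> G j" for j
    using zero_in_perforated_boundary[OF card] pos by (simp add: G_def mem_scale_shift_iff)
  have K_small: "dist y (t j) \<le> real CARD('n) * L j" if y: "y \<in> K j" for y j
  proof -
    obtain z where z: "z \<in> cbox 0 1" "y = L j *\<^sub>R z + t j"
      using y unfolding K_def scale_shift_def by blast
    have "norm z \<le> (\<Sum>i\<in>UNIV. \<bar>z $ i\<bar>)" by (rule norm_le_l1_cart)
    also have "\<dots> \<le> (\<Sum>i\<in>(UNIV::'n set). 1)"
      using z(1) by (intro sum_mono) (simp add: mem_box_cart)
    finally have "L j * norm z \<le> L j * real CARD('n)"
      using pos by (simp add: mult_left_mono less_imp_le)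
    then show ?thesis using pos[of j] by (simp add: z(2) dist_norm mult.commute)
  qed
  have d: "(\<lambda>j. real CARD('n) * L j) \<longlonglongrightarrow> 0"
    using tendsto_mult_right_zero[OF \<open>L \<longlonglongrightarrow> 0\<close>] by simp
  have closure_G: "closure (\<Union>j. G j) = insert 0 (\<Union>j. G j)"
    using closure_Union_insert_limit[OF closedG \<open>t \<longlonglongrightarrow> 0\<close> tG _ d] K_small GK by blast
  \<comment> \<open>An open patch around the limit 0 would contain \<open>t i\<close> for all large
    \<open>i\<close>, but \<open>t i\<close> belongs to the disjoint patch
    \<open>U i\<close>.\<close>
  have zero_notin: "0 \<notin> U j" for j
  proof
    assume "0 \<in> U j"
    then have "eventually (\<lambda>i. t i \<in> U j) sequentially"
      using topological_tendstoD[OF \<open>t \<longlonglongrightarrow> 0\<close> openU] by blast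
    then have "eventually (\<lambda>i. t i \<in> U j \<and> j < i) sequentially"
      by (intro eventually_conj eventually_gt_at_top)
    then obtain i where "t i \<in> U j" "j < i"
      using eventually_happens'[OF sequentially_bot] by blast
    moreover have "t i \<in> U i" using tG[of i] GK[of i] KU[of i] by blast
    ultimately show False using disjoint_family_onD[OF disjU, of i j] by auto
  qed
  have bounded_K: "bounded (\<Union>j. K j)"
  proof -
    have "(\<lambda>j. norm (t j) + real CARD('n) * L j) \<longlonglongrightarrow> norm (0 :: real ^ 'n) + 0"
      by (intro tendsto_add tendsto_norm d \<open>t \<longlonglongrightarrow> 0\<close>)
    then have "bounded (range (\<lambda>j. norm (t j) + real CARD('n) * L j))"
      by (rule convergent_imp_bounded)
    then obtain B where B: "\<And>j. norm (t j) + real CARD('n) * L j \<le> B"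
      unfolding bounded_iff by (metis rangeI real_norm_def abs_le_D1)
    have "norm y \<le> B" if "y \<in> K j" for y j
      using K_small[OF that] B[of j] norm_triangle_ineq[of "t j" "y - t j"] by (simp add: dist_norm)
    then show ?thesis unfolding bounded_iff by blast
  qed
  have disjK: "disjoint_family K"
    by (rule disjoint_family_subset[OF disjU KU])
  have CK: "C j \<subseteq> K j" for j
    using closure_subset closure_C by metis
  have G_frontier: "(\<Union>j. G j) \<subseteq> frontier (\<Union>j. C j)"
  proof -
    have "x \<notin> C i" if "x \<in> G j" for x i j
    proof (cases "i = j")
      case False
      then show ?thesis
        using that GK[of j] CK[of i] disjoint_family_onD[OF disjK, of i j] by blast
    qed (use that GK[of j] in blast)
    then have "(\<Union>j. G j) \<inter> (\<Union>j. C j) = {}" by blast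
    moreover have "K j \<subseteq> closure (\<Union>j. C j)" for j
      unfolding closure_C[symmetric] by (intro closure_mono) blast
    then have "(\<Union>j. G j) \<subseteq> closure (\<Union>j. C j)" using GK by blast
    moreover have "interior (\<Union>j. C j) = (\<Union>j. C j)"
      using openC by (intro interior_open open_UN) auto
    ultimately show ?thesis unfolding frontier_def by blast
  qed
  show ?thesis
  proof (rule that[of t 0, folded C_def G_def])
    show "disjoint_family (\<lambda>j. closure (C j))"
      using disjK by (simp add: closure_C)
    show "disjoint_family G"
      by (rule disjoint_family_subset[OF disjK]) (use GK in blast)
    show "bounded (\<Union>j. C j)"
      by (rule bounded_subset[OF bounded_K]) (use CK in blast)
    show "closure (\<Union>j. G j) \<subseteq> frontier (\<Union>j. C j)"
      using G_frontier by (intro closure_minimal frontier_closed)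
    have "bounded (\<Union>j. G j)"
      by (rule bounded_subset[OF bounded_K]) (use GK in blast)
    then show "compact (closure (\<Union>j. G j))"
      by (simp add: compact_closure)
    show "closure (\<Union>j. G j) = {0} \<union> (\<Union>j. G j)"
      using closure_G by simp
    \<comment> \<open>The union of the \<open>G j\<close> need not be closed, but passing to
      \<open>- {0}\<close> as the ambient space absorbs the only limit point missing from it. This
      gives the openness that the gluing lemma requires.\<close>
    have "UNIV - closure (\<Union>j. G j) = - {0} - (\<Union>j\<in>UNIV. G j)"
      unfolding closure_G by blast
    moreover have "connected (- {0} - (\<Union>j\<in>UNIV. G j))"
    proof (rule connected_diff_Union_patches[where U = U])
      show "connected (- {0} :: (real ^ 'n) set)"
        using card by (intro connected_punctured_universe) simp
      have "- {0} - (\<Union>j\<in>UNIV. G j) = - closure (\<Union>j. G j)"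
        unfolding closure_G by blast
      then show "open (- {0} - (\<Union>j\<in>UNIV. G j))"
        by (simp add: open_Compl)
      show "disjoint_family U" by (rule disjU)
      fix j
      show "open (U j)" by (rule openU)
      show "U j \<subseteq> - {0}" using zero_notin[of j] by blast
      show "G j \<subseteq> U j" using GK KU by blast
      have "U j - G j = scale_shift (L j) (cube_patch - perforated_boundary k (E j)) (t j)"
        by (simp add: U_def G_def scale_shift_Diff pos)
      then show "connected (U j - G j)"
        using connected_cube_patch_diff[OF card E] by (simp add: connected_scale_shift)
      \<comment> \<open>The centre of the cube lies in the patch but not on the perforated
        boundary.\<close>
      have "t j + vec (L j / 2) \<in> C j"
        using pos[of j] by (simp add: C_def mem_scale_shift_iff unit_cube_def)
      then show "U j - G j \<noteq> {}"
        using GK[of j] KU[of j] CK[of j] by blast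
    qed
    ultimately show "connected (UNIV - closure (\<Union>j. G j))" by simp
  qed
qed

theorem theorem1p10:
  fixes k :: "'n::finite"
    and \<epsilon> l :: "nat \<Rightarrow> real"
    and c \<eta> :: real
    and M :: nat
  assumes "CARD('n) \<ge> 2"
    and "\<And>j. j \<ge> 1 \<Longrightarrow> 0 < \<epsilon> j \<and> \<epsilon> j < 1"
    and "\<And>j. j \<ge> 1 \<Longrightarrow> 0 < l j"
    and "antimono_on {1..} l"
    and "c > 0" and "\<eta> > 0" and "M \<ge> 1"
    and "\<And>j. j \<ge> 1 \<Longrightarrow>
      l j \<le> c / ((real j * (\<Prod>m\<in>{1..<M}. iter_log m (real j + iter_exp m))) powr (1 / real CARD('n))
                 * iter_log M (real j + iter_exp M) powr (1 + \<eta>))"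
  shows "\<exists>t :: nat \<Rightarrow> real ^ 'n.
    let Cube = (\<lambda>j. scale_shift (l j) unit_cube (t j));
        Gam = (\<lambda>j. scale_shift (l j) (perforated_boundary k (\<epsilon> j)) (t j));
        Cube_inf = (\<Union>j\<in>{1..}. Cube j);
        \<Gamma> = closure (\<Union>j\<in>{1..}. Gam j);
        \<Omega> = UNIV - \<Gamma>
    in disjoint_family_on (\<lambda>j. closure (Cube j)) {1..}
     \<and> disjoint_family_on Gam {1..}
     \<and> bounded Cube_inf \<and> \<Gamma> \<subseteq> frontier Cube_inf \<and> compact \<Gamma>
     \<and> connected \<Omega>
     \<and> (\<exists>x_inf. \<Gamma> = {x_inf} \<union> (\<Union>j\<in>{1..}. Gam j))"
proof -
  \<comment> \<open>The statement counts from 1 and the packing from 0; the final witness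
    \<open>t (j - 1)\<close> undoes this shift.\<close>
  define L where "L j = l (Suc j)" for j
  define E where "E j = \<epsilon> (Suc j)" for j
  have "summable (\<lambda>j. l j ^ CARD('n))"
    by (rule summable_power_of_iter_log_bound[OF _ assms(6,7,5,3,8)]) simp_all
  then have "summable (\<lambda>j. L j ^ CARD('n))"
    unfolding L_def by (subst summable_Suc_iff)
  moreover have "decseq L"
    unfolding decseq_def L_def using assms(4) by (auto intro: monotone_onD)
  moreover have "0 < E j" "E j < 1" "0 < L j" for j
    using assms(2,3) by (simp_all add: E_def L_def)
  ultimately obtain t :: "nat \<Rightarrow> real ^ 'n" and x_inf where
    t: "disjoint_family (\<lambda>j. closure (scale_shift (L j) unit_cube (t j)))"
      "disjoint_family (\<lambda>j. scale_shift (L j) (perforated_boundary k (E j)) (t j))"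
      "bounded (\<Union>j. scale_shift (L j) unit_cube (t j))"
      "closure (\<Union>j. scale_shift (L j) (perforated_boundary k (E j)) (t j))
        \<subseteq> frontier (\<Union>j. scale_shift (L j) unit_cube (t j))"
      "compact (closure (\<Union>j. scale_shift (L j) (perforated_boundary k (E j)) (t j)))"
      "connected (UNIV - closure (\<Union>j. scale_shift (L j) (perforated_boundary k (E j)) (t j)))"
      "closure (\<Union>j. scale_shift (L j) (perforated_boundary k (E j)) (t j)) =
        {x_inf} \<union> (\<Union>j. scale_shift (L j) (perforated_boundary k (E j)) (t j))"
    using perforated_cubes_packing[OF assms(1), of E L k] by blast
  have range_Suc: "{1..} = range Suc" by (auto simp: image_iff Suc_le_eq gr0_conv_Suc)
  have disj: "disjoint_family_on F {1..}" if "disjoint_family (\<lambda>j. F (Suc j))"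
    for F :: "nat \<Rightarrow> (real ^ 'n) set"
    using that unfolding range_Suc disjoint_family_on_def by auto
  have UN: "(\<Union>j\<in>{1..}. F j) = (\<Union>j. F (Suc j))" for F :: "nat \<Rightarrow> (real ^ 'n) set"
    unfolding range_Suc by auto
  show ?thesis
    unfolding Let_def UN
    by (intro exI[of _ "\<lambda>j. t (j - 1)"] conjI disj exI[of _ x_inf]; unfold diff_Suc_1)
      (fact t[unfolded L_def E_def])+
qed

end
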